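(* Any quantum algorithm that, given quantum oracle access to a text $X[1\,.\,.\,n]$, obtains the LZ77 factorization of $X$ (with $z$ LZ77 factors) requires $\Omega(\sqrt{zn})$ queries, both when restricted to texts with $z=\Theta(1)$ and when restricted to texts with $z=\Theta(n)$. Likewise, any quantum algorithm obtaining the run-length-encoded BWT of $X$ (with $r$ runs) requires $\Omega(\sqrt{rn})$ queries, both when $r=\Theta(1)$ and when $r=\Theta(n)$.
   Context: LZ77 factorization: greedy left-to-right parsing where each phrase is the longest fragment starting at the current position that also occurs starting at an earlier position, or a single character if none exists; $z$ is the number of phrases. $\mathrm{BWT}[i]=X[\mathrm{SA}[i]-1]$ if $\mathrm{SA}[i]\neq1$ and the sentinel $\$$ otherwise, where $\mathrm{SA}$ is the suffix array and $X$ ends with a unique smallest sentinel $\$$; $r$ is the number of maximal runs in $\mathrm{BWT}$. Quantum oracle access to $X$ means access to $|i,b\rangle\mapsto|i,b\oplus X[i]\rangle$; algorithms are bounded-error and the lower bound is on the worst-case number of oracle queries. *)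

theory Defs
  imports Complex_Main "HOL-Library.Landau_Symbols" "HOL-Library.List_Lexorder"
begin

text \<open>
  Texts are lists of natural numbers, and positions are counted from \<open>0\<close>.
\<close>

section \<open>LZ77 factorization\<close>

text \<open>
  The lengths of the nonempty fragments starting at \<open>p\<close> that also occur starting at an earlier
  position; the two occurrences may overlap.
\<close>

definition prev_lens :: "nat list \<Rightarrow> nat \<Rightarrow> nat set" where
  "prev_lens X p =
     {l. 1 \<le> l \<and> p + l \<le> length X \<and> (\<exists>q<p. take l (drop q X) = take l (drop p X))}"

definition phrase_len :: "nat list \<Rightarrow> nat \<Rightarrow> nat" where
  "phrase_len X p = (if prev_lens X p = {} then 1 else Max (prev_lens X p))"

lemma finite_prev_lens: "finite (prev_lens X p)"
  by (rule finite_subset[of _ "{..length X}"]) (auto simp: prev_lens_def)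

lemma phrase_len_pos: "0 < phrase_len X p"
proof (cases "prev_lens X p = {}")
  case False
  with finite_prev_lens have "Max (prev_lens X p) \<in> prev_lens X p"
    by (rule Max_in)
  with False show ?thesis
    by (simp add: phrase_len_def prev_lens_def)
qed (simp add: phrase_len_def)

function lz77_starts_from :: "nat list \<Rightarrow> nat \<Rightarrow> nat list" where
  "lz77_starts_from X p =
     (if p < length X then p # lz77_starts_from X (p + phrase_len X p) else [])"
  by pat_completeness auto
termination
  by (relation "measure (\<lambda>(X, p). length X - p)")
     (use phrase_len_pos in \<open>auto simp: diff_less_mono2\<close>)

declare lz77_starts_from.simps [simp del]

definition lz77_starts :: "nat list \<Rightarrow> nat list" where
  "lz77_starts X = lz77_starts_from X 0"

definition lz77_size :: "nat list \<Rightarrow> nat" where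
  "lz77_size X = length (lz77_starts X)"

text \<open>
  A phrase is reported as a fresh character or as the source position and length of a copy.
  The source need not be unique, so a text may have several correct encodings; each of them
  counts as a correct answer.
\<close>

datatype phrase = Literal nat | Copy nat nat

fun encodes_phrase :: "nat list \<Rightarrow> nat \<Rightarrow> phrase \<Rightarrow> bool" where
  "encodes_phrase X p (Literal c) \<longleftrightarrow> prev_lens X p = {} \<and> c = X ! p"
| "encodes_phrase X p (Copy q l) \<longleftrightarrow>
     prev_lens X p \<noteq> {} \<and> l = phrase_len X p \<and> q < p \<and> take l (drop q X) = take l (drop p X)"

definition is_lz77 :: "nat list \<Rightarrow> phrase list \<Rightarrow> bool" where
  "is_lz77 X fs \<longleftrightarrow> list_all2 (encodes_phrase X) (lz77_starts X) fs"


section \<open>Run-length-encoded Burrows--Wheeler transform\<close>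

text \<open>The sentinel is the letter \<open>0\<close>, the smallest one.\<close>

definition ends_with_sentinel :: "nat list \<Rightarrow> bool" where
  "ends_with_sentinel X \<longleftrightarrow> X \<noteq> [] \<and> last X = 0 \<and> 0 \<notin> set (butlast X)"

definition suffix_array :: "nat list \<Rightarrow> nat list" where
  "suffix_array X = sort_key (\<lambda>i. drop i X) [0..<length X]"

definition bwt :: "nat list \<Rightarrow> nat list" where
  "bwt X = map (\<lambda>i. if i \<noteq> 0 then X ! (i - 1) else 0) (suffix_array X)"

fun run_length_encode :: "'a list \<Rightarrow> ('a \<times> nat) list" where
  "run_length_encode [] = []"
| "run_length_encode (x # xs) =
     (case run_length_encode xs of
        [] \<Rightarrow> [(x, 1)]
      | (y, k) # rs \<Rightarrow> if x = y then (y, Suc k) # rs else (x, 1) # (y, k) # rs)"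

definition is_rlbwt :: "nat list \<Rightarrow> (nat \<times> nat) list \<Rightarrow> bool" where
  "is_rlbwt X rs \<longleftrightarrow> rs = run_length_encode (bwt X)"

definition bwt_runs :: "nat list \<Rightarrow> nat" where
  "bwt_runs X = length (run_length_encode (bwt X))"


section \<open>Quantum query algorithms\<close>

text \<open>
  A basis state \<open>(i, b, a)\<close> consists of an index register \<open>i\<close>, an answer register \<open>b\<close> of \<open>w\<close> bits,
  and a workspace register \<open>a\<close> of arbitrary finite dimension \<open>d\<close>. States and operators are given
  by their amplitudes and matrix entries; only values on \<open>qbasis\<close> matter.
\<close>

type_synonym qindex = "nat \<times> nat \<times> nat"

definition qbasis :: "nat \<Rightarrow> nat \<Rightarrow> nat \<Rightarrow> qindex set" where
  "qbasis n w d = {..<n} \<times> {..<2 ^ w} \<times> {..<d}"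

definition unitary_on :: "'i set \<Rightarrow> ('i \<Rightarrow> 'i \<Rightarrow> complex) \<Rightarrow> bool" where
  "unitary_on B U \<longleftrightarrow>
     (\<forall>x\<in>B. \<forall>y\<in>B. (\<Sum>k\<in>B. cnj (U k x) * U k y) = (if x = y then 1 else 0)) \<and>
     (\<forall>x\<in>B. \<forall>y\<in>B. (\<Sum>k\<in>B. U x k * cnj (U y k)) = (if x = y then 1 else 0))"

definition apply_op ::
  "'i set \<Rightarrow> ('i \<Rightarrow> 'i \<Rightarrow> complex) \<Rightarrow> ('i \<Rightarrow> complex) \<Rightarrow> 'i \<Rightarrow> complex" where
  "apply_op B U \<psi> x = (\<Sum>y\<in>B. U x y * \<psi> y)"

text \<open>
  The oracle sends the basis state \<open>(i, b, a)\<close> to \<open>(i, b XOR X ! i, a)\<close>. This map on basis states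
  is an involution, so its action on amplitudes is composition with the map itself.
\<close>

definition apply_oracle :: "nat list \<Rightarrow> (qindex \<Rightarrow> complex) \<Rightarrow> qindex \<Rightarrow> complex" where
  "apply_oracle X \<psi> = (\<lambda>(i, b, a). \<psi> (i, Bit_Operations.xor b (X ! i), a))"

text \<open>
  An algorithm starts in the basis state \<open>(0, 0, 0)\<close>, applies \<open>gate 0\<close>, a query, \<open>gate 1\<close>,
  a query, and so on up to \<open>gate queries\<close>, measures all registers, and outputs the result of
  applying \<open>decode\<close> to the outcome.
\<close>

datatype 'o qalg = QAlg
  (workspace: nat)
  (queries: nat)
  (gate: "nat \<Rightarrow> qindex \<Rightarrow> qindex \<Rightarrow> complex")
  (decode: "qindex \<Rightarrow> 'o")

definition alg_basis :: "nat \<Rightarrow> nat \<Rightarrow> 'o qalg \<Rightarrow> qindex set" where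
  "alg_basis n w A = qbasis n w (workspace A)"

definition valid_qalg :: "nat \<Rightarrow> nat \<Rightarrow> 'o qalg \<Rightarrow> bool" where
  "valid_qalg n w A \<longleftrightarrow>
     0 < workspace A \<and> (\<forall>t\<le>queries A. unitary_on (alg_basis n w A) (gate A t))"

fun qstate :: "nat \<Rightarrow> nat \<Rightarrow> 'o qalg \<Rightarrow> nat list \<Rightarrow> nat \<Rightarrow> qindex \<Rightarrow> complex" where
  "qstate n w A X 0 =
     apply_op (alg_basis n w A) (gate A 0) (\<lambda>x. if x = (0, 0, 0) then 1 else 0)"
| "qstate n w A X (Suc t) =
     apply_op (alg_basis n w A) (gate A (Suc t)) (apply_oracle X (qstate n w A X t))"

definition success_prob ::
  "nat \<Rightarrow> nat \<Rightarrow> 'o qalg \<Rightarrow> nat list \<Rightarrow> ('o \<Rightarrow> bool) \<Rightarrow> real" where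
  "success_prob n w A X good =
     (\<Sum>x \<in> {x \<in> alg_basis n w A. good (decode A x)}. (cmod (qstate n w A X (queries A) x))\<^sup>2)"

definition texts :: "nat \<Rightarrow> nat \<Rightarrow> nat list set" where
  "texts n w = {X. length X = n \<and> set X \<subseteq> {..<2 ^ w}}"

definition solves ::
  "nat \<Rightarrow> nat \<Rightarrow> (nat list \<Rightarrow> bool) \<Rightarrow> (nat list \<Rightarrow> 'o \<Rightarrow> bool) \<Rightarrow> 'o qalg \<Rightarrow> bool" where
  "solves n w P correct A \<longleftrightarrow>
     valid_qalg n w A \<and> (\<forall>X\<in>texts n w. P X \<longrightarrow> success_prob n w A X (correct X) \<ge> 2 / 3)"

text \<open>
  \<open>requires_queries P correct f\<close>: every (possibly non-uniform) family of bounded-error algorithms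
  that, for large \<open>n\<close>, is correct on all texts of length \<open>n\<close> satisfying \<open>P n\<close> makes \<open>\<Omega>(f n)\<close>
  queries. The letters are \<open>w n\<close>-bit integers, where \<open>w\<close> is any word size for which the alphabet
  has at least \<open>n\<close> letters; over a bounded alphabet the number of LZ77 phrases is \<open>o(n)\<close>.
\<close>

definition requires_queries ::
  "(nat \<Rightarrow> nat list \<Rightarrow> bool) \<Rightarrow> (nat list \<Rightarrow> 'o \<Rightarrow> bool) \<Rightarrow> (nat \<Rightarrow> real) \<Rightarrow> bool" where
  "requires_queries P correct f \<longleftrightarrow>
     (\<forall>(w :: nat \<Rightarrow> nat) (A :: nat \<Rightarrow> 'o qalg).
        (\<forall>\<^sub>F n in sequentially. n \<le> 2 ^ w n \<and> solves n (w n) (P n) correct (A n)) \<longrightarrow>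
        (\<lambda>n. real (queries (A n))) \<in> \<Omega>(f))"

end

theory Submission
  imports Defs "HOL-Library.Multiset"
begin

text \<open>
  All four bounds come from the weighted quantum adversary method: on a set of texts with pairwise
  incompatible answers along a relation, the sum over related pairs of the overlaps between the two
  algorithm states must drop by a constant factor, while a single query changes it only a little.

  For \<open>\<Theta>(1)\<close> factors or runs, take the texts \<open>1\<^sup>i 2 1\<^sup>k 0\<close> with all pairs related. They have five LZ77
  phrases (if \<open>1 \<le> k \<le> i\<close> and \<open>i \<ge> 2\<close>) and transform \<open>1\<^sup>k 2 0 1\<^sup>i\<close>, so solving the problem amounts to
  finding the letter \<open>2\<close>, as in unordered search. For \<open>\<Theta>(n)\<close>, take the texts obtained from
  \<open>1, 2, \<dots>, n - 1, 0\<close> by swapping any set of the disjoint pairs \<open>(1, 2), (3, 4), \<dots>\<close>, with two texts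
  related if they differ in one swap. Since the letters are distinct, there are exactly \<open>n\<close> phrases
  and \<open>n\<close> runs, and an answer reveals about \<open>n / 2\<close> independent bits.
\<close>

section \<open>The adversary bound\<close>

definition inner_on :: "'i set \<Rightarrow> ('i \<Rightarrow> complex) \<Rightarrow> ('i \<Rightarrow> complex) \<Rightarrow> complex" where
  "inner_on B \<phi> \<psi> = (\<Sum>x\<in>B. cnj (\<phi> x) * \<psi> x)"

text \<open>The squared norm of the part of a state on \<open>B\<close>. For a set of outcomes of a
  unit state it is the probability of measuring one of them.\<close>

definition mass_on :: "'i set \<Rightarrow> ('i \<Rightarrow> complex) \<Rightarrow> real" where
  "mass_on B \<phi> = (\<Sum>x\<in>B. (cmod (\<phi> x))\<^sup>2)"

lemma mass_on_nonneg: "0 \<le> mass_on B \<phi>"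
  by (simp add: mass_on_def sum_nonneg)

lemma inner_on_self: "inner_on B \<phi> \<phi> = complex_of_real (mass_on B \<phi>)"
  by (simp add: inner_on_def mass_on_def complex_norm_square mult.commute del: of_real_power)

text \<open>Summing over the output index first leaves the Gram matrix of the columns of
  \<open>U\<close>, which is the identity. Hence gates preserve overlaps, and only queries can
  change them.\<close>

lemma inner_on_apply_op:
  assumes "finite B" and U: "unitary_on B U"
  shows "inner_on B (apply_op B U \<phi>) (apply_op B U \<psi>) = inner_on B \<phi> \<psi>"
proof -
  have "inner_on B (apply_op B U \<phi>) (apply_op B U \<psi>) =
      (\<Sum>x\<in>B. \<Sum>y\<in>B. \<Sum>z\<in>B. cnj (U x y) * cnj (\<phi> y) * (U x z * \<psi> z))"
    by (simp add: inner_on_def apply_op_def sum_product)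
  also have "\<dots> = (\<Sum>y\<in>B. \<Sum>x\<in>B. \<Sum>z\<in>B. cnj (U x y) * cnj (\<phi> y) * (U x z * \<psi> z))"
    by (rule sum.swap)
  also have "\<dots> = (\<Sum>y\<in>B. \<Sum>z\<in>B. \<Sum>x\<in>B. cnj (U x y) * cnj (\<phi> y) * (U x z * \<psi> z))"
    by (intro sum.cong refl sum.swap)
  also have "\<dots> = (\<Sum>y\<in>B. \<Sum>z\<in>B. cnj (\<phi> y) * \<psi> z * (\<Sum>x\<in>B. cnj (U x y) * U x z))"
    by (simp add: sum_distrib_left mult_ac)
  also have "\<dots> = (\<Sum>y\<in>B. \<Sum>z\<in>B. if y = z then cnj (\<phi> y) * \<psi> z else 0)"
    using U by (intro sum.cong refl) (simp add: unitary_on_def)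
  also have "\<dots> = inner_on B \<phi> \<psi>"
    using assms(1) by (simp add: inner_on_def)
  finally show ?thesis .
qed

lemma weighted_am_gm:
  fixes u v x y :: real
  assumes "0 < u" "1 \<le> u * v"
  shows "x * y \<le> (u * x\<^sup>2 + v * y\<^sup>2) / 2"
proof -
  have "1 / u \<le> v"
    using assms by (simp add: divide_simps mult.commute)
  then have "(1 / u) * y\<^sup>2 \<le> v * y\<^sup>2"
    by (intro mult_right_mono) auto
  moreover have "0 \<le> u * (x - y / u)\<^sup>2"
    using assms by simp
  moreover have "u * (x - y / u)\<^sup>2 = u * x\<^sup>2 - 2 * (x * y) + (1 / u) * y\<^sup>2"
    using assms by (simp add: power2_eq_square field_simps)
  ultimately show ?thesis by argo
qed

text \<open>A linearized Cauchy-Schwarz bound; the free weights later let each position shift the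
  cost of a query from one state to the other.\<close>

lemma cmod_inner_on_le:
  assumes "0 < u" "1 \<le> u * v"
  shows "cmod (inner_on B \<phi> \<psi>) \<le> (u * mass_on B \<phi> + v * mass_on B \<psi>) / 2"
proof -
  have "cmod (inner_on B \<phi> \<psi>) \<le> (\<Sum>x\<in>B. cmod (\<phi> x) * cmod (\<psi> x))"
    unfolding inner_on_def by (rule order_trans[OF norm_sum]) (simp add: norm_mult)
  also have "\<dots> \<le> (\<Sum>x\<in>B. (u * (cmod (\<phi> x))\<^sup>2 + v * (cmod (\<psi> x))\<^sup>2) / 2)"
    by (intro sum_mono weighted_am_gm assms)
  also have "\<dots> = (u * mass_on B \<phi> + v * mass_on B \<psi>) / 2"
    by (simp add: mass_on_def sum_distrib_left sum.distrib add_divide_distrib sum_divide_distrib)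
  finally show ?thesis .
qed

section \<open>Action of the oracle on the basis states that query a fixed position\<close>

definition qblock :: "nat \<Rightarrow> nat \<Rightarrow> nat \<Rightarrow> qindex set" where
  "qblock w d i = {i} \<times> {..<2 ^ w} \<times> {..<d}"

lemma finite_qbasis [simp]: "finite (qbasis n w d)"
  by (simp add: qbasis_def)

lemma sum_qbasis: "(\<Sum>x\<in>qbasis n w d. f x) = (\<Sum>i<n. \<Sum>x\<in>qblock w d i. f x)"
proof -
  have "qbasis n w d = (\<Union>i<n. qblock w d i)"
    by (auto simp: qbasis_def qblock_def)
  then show ?thesis
    by (simp only:) (intro sum.UNION_disjoint, auto simp: qblock_def)
qed

lemma inner_on_qbasis: "inner_on (qbasis n w d) \<phi> \<psi> = (\<Sum>i<n. inner_on (qblock w d i) \<phi> \<psi>)"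
  by (simp add: inner_on_def sum_qbasis)

lemma mass_on_qbasis: "mass_on (qbasis n w d) \<phi> = (\<Sum>i<n. mass_on (qblock w d i) \<phi>)"
  by (simp add: mass_on_def sum_qbasis)

lemma xor_nat_less_power:
  fixes b c :: nat
  assumes "b < 2 ^ w" "c < 2 ^ w"
  shows "Bit_Operations.xor b c < 2 ^ w"
proof -
  have "take_bit w (Bit_Operations.xor b c) = Bit_Operations.xor b c"
    using assms by (simp add: take_bit_nat_eq_self)
  then show ?thesis by (simp only: take_bit_nat_eq_self_iff)
qed

text \<open>XOR with a \<open>w\<close>-bit letter is an involution of the block, so the sum is
  merely reindexed.\<close>

lemma sum_qblock_oracle:
  assumes "X ! i < 2 ^ w"
  shows "(\<Sum>(j, b, a)\<in>qblock w d i. f (j, Bit_Operations.xor b (X ! j), a)) = sum f (qblock w d i)"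
proof -
  let ?h = "\<lambda>(j, b, a). (j, Bit_Operations.xor b (X ! j), a)"
  have "(\<Sum>x\<in>qblock w d i. f (?h x)) = sum f (qblock w d i)"
    by (rule sum.reindex_bij_witness[of _ ?h ?h])
      (use assms in \<open>auto simp: qblock_def xor_nat_less_power xor.assoc\<close>)
  then show ?thesis by (simp add: case_prod_unfold)
qed

text \<open>Where the two letters agree, both oracles permute the block in the same way.\<close>

lemma inner_on_qblock_oracle:
  assumes "X ! i < 2 ^ w" "X ! i = Y ! i"
  shows "inner_on (qblock w d i) (apply_oracle X \<phi>) (apply_oracle Y \<psi>) = inner_on (qblock w d i) \<phi> \<psi>"
proof -
  have "inner_on (qblock w d i) (apply_oracle X \<phi>) (apply_oracle Y \<psi>) =
    (\<Sum>(j, b, a)\<in>qblock w d i. (\<lambda>x. cnj (\<phi> x) * \<psi> x) (j, Bit_Operations.xor b (X ! j), a))"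
    unfolding inner_on_def
    by (intro sum.cong refl) (use assms(2) in \<open>auto simp: qblock_def apply_oracle_def\<close>)
  then show ?thesis
    using sum_qblock_oracle[OF assms(1), where d = d and f = "\<lambda>x. cnj (\<phi> x) * \<psi> x"]
    by (simp add: inner_on_def)
qed

lemma mass_on_qblock_oracle:
  assumes "X ! i < 2 ^ w"
  shows "mass_on (qblock w d i) (apply_oracle X \<phi>) = mass_on (qblock w d i) \<phi>"
  using inner_on_qblock_oracle[OF assms refl, of d \<phi> \<phi>]
  by (simp only: inner_on_self of_real_eq_iff)

text \<open>Blocks on which the letters agree contribute equally before and after the query. On any
  other block the old and the new contribution are each at most half of the weighted mass, since the
  oracle preserves the mass of a block.\<close>

lemma inner_on_oracle_diff:
  assumes X: "\<And>i. i < n \<Longrightarrow> X ! i < 2 ^ w" and Y: "\<And>i. i < n \<Longrightarrow> Y ! i < 2 ^ w"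
    and uv: "\<And>i. i < n \<Longrightarrow> X ! i \<noteq> Y ! i \<Longrightarrow> 0 < u i \<and> 1 \<le> u i * v i"
  shows "cmod (inner_on (qbasis n w d) \<phi> \<psi>)
      \<le> cmod (inner_on (qbasis n w d) (apply_oracle X \<phi>) (apply_oracle Y \<psi>)) +
        (\<Sum>i | i < n \<and> X ! i \<noteq> Y ! i.
          u i * mass_on (qblock w d i) \<phi> + v i * mass_on (qblock w d i) \<psi>)"
proof -
  let ?g = "\<lambda>i. inner_on (qblock w d i) \<phi> \<psi>"
  let ?g' = "\<lambda>i. inner_on (qblock w d i) (apply_oracle X \<phi>) (apply_oracle Y \<psi>)"
  let ?D = "{i. i < n \<and> X ! i \<noteq> Y ! i}"
  let ?b = "\<lambda>i. u i * mass_on (qblock w d i) \<phi> + v i * mass_on (qblock w d i) \<psi>"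
  have "inner_on (qbasis n w d) \<phi> \<psi> =
      inner_on (qbasis n w d) (apply_oracle X \<phi>) (apply_oracle Y \<psi>) + (\<Sum>i<n. ?g i - ?g' i)"
    by (simp add: inner_on_qbasis sum_subtractf)
  moreover have "(\<Sum>i<n. ?g i - ?g' i) = (\<Sum>i\<in>?D. ?g i - ?g' i)"
    by (rule sum.mono_neutral_right) (auto intro!: inner_on_qblock_oracle[symmetric] X)
  moreover have "cmod (\<Sum>i\<in>?D. ?g i - ?g' i) \<le> (\<Sum>i\<in>?D. ?b i)"
  proof (rule order_trans[OF norm_sum], rule sum_mono)
    fix i assume i: "i \<in> ?D"
    have uv': "0 < u i" "1 \<le> u i * v i" using uv i by auto
    have "cmod (?g i) \<le> ?b i / 2" by (rule cmod_inner_on_le[OF uv'])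
    moreover have "cmod (?g' i) \<le> ?b i / 2"
      using cmod_inner_on_le[OF uv', of "qblock w d i" "apply_oracle X \<phi>" "apply_oracle Y \<psi>"] i X Y
      by (simp add: mass_on_qblock_oracle)
    moreover have "cmod (?g i - ?g' i) \<le> cmod (?g i) + cmod (?g' i)"
      by (rule norm_triangle_ineq4)
    ultimately show "cmod (?g i - ?g' i) \<le> ?b i" by argo
  qed
  ultimately show ?thesis
    by (smt (verit) norm_triangle_ineq)
qed

section \<open>Overlaps and norms along the run of an algorithm\<close>

lemma texts_nth_less: "X \<in> texts n w \<Longrightarrow> i < n \<Longrightarrow> X ! i < 2 ^ w"
  using nth_mem by (fastforce simp: texts_def)

text \<open>Before the first query the state does not depend on the text; \<open>0 < n\<close> puts
  \<open>(0, 0, 0)\<close> into the basis.\<close>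

lemma inner_on_qstate_0:
  assumes "valid_qalg n w A" "0 < n"
  shows "inner_on (alg_basis n w A) (qstate n w A X 0) (qstate n w A Y 0) = 1"
proof -
  have "(0, 0, 0) \<in> alg_basis n w A"
    using assms by (auto simp: alg_basis_def qbasis_def valid_qalg_def)
  moreover have "finite (alg_basis n w A)" by (simp add: alg_basis_def)
  ultimately have "inner_on (alg_basis n w A) (\<lambda>x. if x = (0, 0, 0) then 1 else 0)
      (\<lambda>x. if x = (0, 0, 0) then 1 else 0) = 1"
    by (simp add: inner_on_def if_distrib if_distribR cong: if_cong)
  then show ?thesis
    using assms \<open>finite _\<close> by (simp add: inner_on_apply_op valid_qalg_def)
qed

lemma inner_on_qstate_Suc:
  assumes "valid_qalg n w A" "Suc t \<le> queries A"
  shows "inner_on (alg_basis n w A) (qstate n w A X (Suc t)) (qstate n w A Y (Suc t)) =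
    inner_on (alg_basis n w A) (apply_oracle X (qstate n w A X t)) (apply_oracle Y (qstate n w A Y t))"
  using assms by (simp add: inner_on_apply_op valid_qalg_def alg_basis_def)

lemma mass_on_qstate:
  assumes "valid_qalg n w A" "0 < n" "X \<in> texts n w" "t \<le> queries A"
  shows "mass_on (alg_basis n w A) (qstate n w A X t) = 1"
proof -
  have "inner_on (alg_basis n w A) (qstate n w A X t) (qstate n w A X t) = 1"
    using assms(4)
  proof (induction t)
    case 0
    then show ?case using inner_on_qstate_0[OF assms(1,2)] by simp
  next
    case (Suc t)
    have "inner_on (alg_basis n w A) (apply_oracle X (qstate n w A X t)) (apply_oracle X (qstate n w A X t))
        = inner_on (alg_basis n w A) (qstate n w A X t) (qstate n w A X t)"
      by (simp add: alg_basis_def inner_on_qbasis inner_on_qblock_oracle texts_nth_less[OF assms(3)])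
    then show ?case
      using Suc inner_on_qstate_Suc[OF assms(1) Suc.prems] by simp
  qed
  then show ?thesis by (simp add: inner_on_self)
qed

text \<open>Disjointness forces \<psi> to put at least 2/3 of its mass outside \<open>G\<close>,
  while \<phi> puts as much inside. The reciprocal weights 3/4 and 4/3 approximate the optimal 1 /
  sqrt 2 and sqrt 2; with g and h for these two masses the bound is (8/3 - 7/12 (g + h)) / 2, which
  is at most 17/18.\<close>

lemma cmod_inner_on_separated:
  assumes "finite B" "mass_on B \<phi> = 1" "mass_on B \<psi> = 1"
    and "G \<subseteq> B" "H \<subseteq> B" "G \<inter> H = {}"
    and "2 / 3 \<le> mass_on G \<phi>" "2 / 3 \<le> mass_on H \<psi>"
  shows "cmod (inner_on B \<phi> \<psi>) \<le> 17 / 18"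
proof -
  have split: "mass_on B f = mass_on G f + mass_on (B - G) f" for f
    unfolding mass_on_def using assms by (simp add: sum.subset_diff[of G B] add.commute)
  have "mass_on H \<psi> \<le> mass_on (B - G) \<psi>"
    unfolding mass_on_def using assms by (intro sum_mono2) auto
  have "inner_on B \<phi> \<psi> = inner_on G \<phi> \<psi> + inner_on (B - G) \<phi> \<psi>"
    unfolding inner_on_def using assms by (simp add: sum.subset_diff[of G B] add.commute)
  then have "cmod (inner_on B \<phi> \<psi>) \<le> cmod (inner_on G \<phi> \<psi>) + cmod (inner_on (B - G) \<phi> \<psi>)"
    by (simp add: norm_triangle_ineq)
  moreover have "cmod (inner_on G \<phi> \<psi>) \<le> (3/4 * mass_on G \<phi> + 4/3 * mass_on G \<psi>) / 2"
    by (rule cmod_inner_on_le) auto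
  moreover have "cmod (inner_on (B - G) \<phi> \<psi>) \<le> (4/3 * mass_on (B - G) \<phi> + 3/4 * mass_on (B - G) \<psi>) / 2"
    by (rule cmod_inner_on_le) auto
  ultimately show ?thesis
    using split[of \<phi>] split[of \<psi>] assms(2,3,7,8) \<open>mass_on H \<psi> \<le> _\<close> by argo
qed

text \<open>The total overlap \<open>W\<close> starts at \<open>card R\<close> and ends at no more
  than 17/18 of it, while a query lowers it by at most \<open>2 * L * card I\<close>; this gives the
  factor 36 = 2 * 18. Here \<open>u a b i\<close> is the price charged to \<open>a\<close> for being
  told from \<open>b\<close> at position \<open>i\<close>, \<open>L\<close> bounds the total price
  at a position, and \<open>D\<close> is at most the average degree of \<open>R\<close>.\<close>

theorem adversary_bound:
  fixes X :: "'a \<Rightarrow> nat list" and u :: "'a \<Rightarrow> 'a \<Rightarrow> nat \<Rightarrow> real"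
  assumes fin: "finite I" and ne: "I \<noteq> {}" and "0 < n"
    and sol: "solves n w P correct A"
    and X: "\<And>a. a \<in> I \<Longrightarrow> X a \<in> texts n w" and P: "\<And>a. a \<in> I \<Longrightarrow> P (X a)"
    and R: "R \<subseteq> I \<times> I" and "sym R"
    and sep: "\<And>a b y. (a, b) \<in> R \<Longrightarrow> correct (X a) y \<Longrightarrow> \<not> correct (X b) y"
    and u: "\<And>a b i. (a, b) \<in> R \<Longrightarrow> i < n \<Longrightarrow> X a ! i \<noteq> X b ! i \<Longrightarrow>
              0 < u a b i \<and> 1 \<le> u a b i * u b a i"
    and L: "\<And>a i. a \<in> I \<Longrightarrow> i < n \<Longrightarrow>
              (\<Sum>b | (a, b) \<in> R \<and> X a ! i \<noteq> X b ! i. u a b i) \<le> L"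
    and D: "D * real (card I) \<le> real (card R)"
  shows "D \<le> 36 * L * real (queries A)"
proof -
  define B where "B = alg_basis n w A"
  define s where "s a t = qstate n w A (X a) t" for a t
  define W where "W t = (\<Sum>(a, b)\<in>R. cmod (inner_on B (s a t) (s b t)))" for t
  define M where "M a t i = mass_on (qblock w (workspace A) i) (s a t)" for a t i
  have val: "valid_qalg n w A" and succ: "\<And>a. a \<in> I \<Longrightarrow> 2 / 3 \<le> success_prob n w A (X a) (correct (X a))"
    using sol X P by (auto simp: solves_def)
  have finR: "finite R" using R fin finite_subset by blast
  have mass: "mass_on B (s a t) = 1" if "a \<in> I" "t \<le> queries A" for a t
    unfolding B_def s_def by (rule mass_on_qstate) (use val that X \<open>0 < n\<close> in auto)
  have W0: "W 0 = real (card R)"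
    by (simp add: W_def B_def s_def inner_on_qstate_0[OF val \<open>0 < n\<close>] del: qstate.simps)
  have "cmod (inner_on B (s a (queries A)) (s b (queries A))) \<le> 17 / 18" if ab: "(a, b) \<in> R" for a b
  proof (rule cmod_inner_on_separated)
    show "{x \<in> B. correct (X a) (decode A x)} \<inter> {x \<in> B. correct (X b) (decode A x)} = {}"
      using sep ab by auto
    show "2 / 3 \<le> mass_on {x \<in> B. correct (X a) (decode A x)} (s a (queries A))"
      "2 / 3 \<le> mass_on {x \<in> B. correct (X b) (decode A x)} (s b (queries A))"
      using succ[of a] succ[of b] ab R by (auto simp: success_prob_def mass_on_def B_def s_def)
  qed (use mass ab R in \<open>auto simp: B_def alg_basis_def\<close>)
  then have WT: "W (queries A) \<le> real (card R) * (17 / 18)"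
    unfolding W_def by (intro sum_bounded_above) auto
  have step: "W t \<le> W (Suc t) + 2 * L * real (card I)" if t: "Suc t \<le> queries A" for t
  proof -
    let ?d = "\<lambda>a b. {i. i < n \<and> X a ! i \<noteq> X b ! i}"
    have "cmod (inner_on B (s a t) (s b t)) \<le> cmod (inner_on B (s a (Suc t)) (s b (Suc t))) +
        (\<Sum>i\<in>?d a b. u a b i * M a t i + u b a i * M b t i)" if ab: "(a, b) \<in> R" for a b
    proof -
      have "a \<in> I" "b \<in> I" using ab R by auto
      then show ?thesis
        unfolding s_def B_def M_def inner_on_qstate_Suc[OF val t] unfolding alg_basis_def
        by (intro inner_on_oracle_diff texts_nth_less[OF X] u[OF ab]) auto
    qed
    then have "W t \<le> (\<Sum>(a, b)\<in>R. cmod (inner_on B (s a (Suc t)) (s b (Suc t))) +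
        (\<Sum>i\<in>?d a b. u a b i * M a t i + u b a i * M b t i))"
      unfolding W_def by (intro sum_mono) auto
    also have "\<dots> = W (Suc t) + ((\<Sum>(a, b)\<in>R. \<Sum>i\<in>?d a b. u a b i * M a t i) +
        (\<Sum>(a, b)\<in>R. \<Sum>i\<in>?d a b. u b a i * M b t i))"
      by (simp add: W_def sum.distrib case_prod_unfold)
    \<comment> \<open>Symmetry of \<open>R\<close> makes the two halves of the loss equal, whence
      the factor 2.\<close>
    also have "(\<Sum>(a, b)\<in>R. \<Sum>i\<in>?d a b. u b a i * M b t i) = (\<Sum>(a, b)\<in>R. \<Sum>i\<in>?d a b. u a b i * M a t i)"
      by (rule sum.reindex_bij_witness[of _ prod.swap prod.swap])
        (use \<open>sym R\<close> in \<open>auto dest: symD intro!: sum.cong\<close>)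
    also have "(\<Sum>(a, b)\<in>R. \<Sum>i\<in>?d a b. u a b i * M a t i) \<le> L * real (card I)"
    proof -
      have R_eq: "Sigma I (\<lambda>a. {b. (a, b) \<in> R}) = R" using R by auto
      have finb: "finite {b. (a, b) \<in> R}" for a
        by (rule finite_subset[of _ I]) (use R fin in auto)
      have "(\<Sum>(a, b)\<in>R. \<Sum>i\<in>?d a b. u a b i * M a t i) =
          (\<Sum>a\<in>I. \<Sum>b | (a, b) \<in> R. \<Sum>i\<in>?d a b. u a b i * M a t i)"
        using sum.Sigma[of I "\<lambda>a. {b. (a, b) \<in> R}" "\<lambda>a b. \<Sum>i\<in>?d a b. u a b i * M a t i"] fin finb
        unfolding R_eq by simp
      also have "\<dots> \<le> (\<Sum>a\<in>I. L)"
      proof (rule sum_mono)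
        fix a assume a: "a \<in> I"
        \<comment> \<open>Exchanging the sums collects, at each position, the prices of all
          neighbours differing from \<open>a\<close> there. These are bounded by \<open>L\<close>,
          and the block masses add up to 1.\<close>
        have "(\<Sum>b | (a, b) \<in> R. \<Sum>i\<in>?d a b. u a b i * M a t i) =
            (\<Sum>i<n. \<Sum>b | (a, b) \<in> R \<and> X a ! i \<noteq> X b ! i. u a b i * M a t i)"
          using sum.swap_restrict[OF finb[of a] finite_lessThan[of n],
              of "\<lambda>b i. u a b i * M a t i" "\<lambda>b i. X a ! i \<noteq> X b ! i"] by simp
        also have "\<dots> \<le> (\<Sum>i<n. L * M a t i)"
          using L[OF a] by (intro sum_mono)
            (simp add: sum_distrib_right[symmetric] M_def mass_on_nonneg mult_right_mono)
        also have "\<dots> = L * mass_on B (s a t)"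
          by (simp add: sum_distrib_left B_def alg_basis_def mass_on_qbasis M_def)
        finally show "(\<Sum>b | (a, b) \<in> R. \<Sum>i\<in>?d a b. u a b i * M a t i) \<le> L"
          using mass[OF a] t by simp
      qed
      finally show ?thesis by (simp add: mult.commute)
    qed
    finally show ?thesis by simp
  qed
  have "W 0 \<le> W t + real t * (2 * L * real (card I))" if "t \<le> queries A" for t
    using that
  proof (induction t)
    case (Suc t)
    then show ?case using step[of t] by (simp add: algebra_simps)
  qed simp
  from this[of "queries A"] have "real (card R) \<le> 36 * L * real (queries A) * real (card I)"
    using W0 WT by (simp add: algebra_simps)
  then have "D * real (card I) \<le> 36 * L * real (queries A) * real (card I)"
    using D by linarith
  moreover have "0 < card I" using fin ne by (simp add: card_gt_0_iff)
  ultimately show ?thesis by simp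
qed

section \<open>LZ77 phrases and the BWT\<close>

lemma take_drop_eq_iff:
  assumes "p + l \<le> length X" "q + l \<le> length X"
  shows "take l (drop q X) = take l (drop p X) \<longleftrightarrow> (\<forall>k<l. X ! (q + k) = X ! (p + k))"
  using assms by (auto simp: list_eq_iff_nth_eq)

text \<open>A source to the left of \<open>p\<close> stays inside the text whenever the target does,
  so fragments can be compared letter by letter.\<close>

lemma mem_prev_lens_iff:
  "l \<in> prev_lens X p \<longleftrightarrow>
     1 \<le> l \<and> p + l \<le> length X \<and> (\<exists>q<p. \<forall>k<l. X ! (q + k) = X ! (p + k))"
proof -
  have "take l (drop q X) = take l (drop p X) \<longleftrightarrow> (\<forall>k<l. X ! (q + k) = X ! (p + k))"
    if "p + l \<le> length X" "q < p" for q
    using that by (intro take_drop_eq_iff) auto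
  then show ?thesis by (auto simp: prev_lens_def)
qed

lemma prev_lens_empty_iff:
  assumes "p < length X"
  shows "prev_lens X p = {} \<longleftrightarrow> (\<forall>q<p. X ! q \<noteq> X ! p)"
proof -
  have "prev_lens X p = {} \<longleftrightarrow> 1 \<notin> prev_lens X p"
    unfolding mem_prev_lens_iff set_eq_iff by fastforce
  then show ?thesis using assms by (auto simp: mem_prev_lens_iff)
qed

text \<open>Nonempty prefixes of a repeated fragment are repeated, so one missing length above
  \<open>l\<close> excludes all longer ones.\<close>

lemma phrase_len_eqI:
  assumes "l \<in> prev_lens X p" "Suc l \<notin> prev_lens X p"
  shows "phrase_len X p = l"
proof -
  have "m \<le> l" if "m \<in> prev_lens X p" for m
  proof (rule ccontr)
    assume "\<not> m \<le> l"
    then have "Suc l \<in> prev_lens X p"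
      using that assms(1) unfolding mem_prev_lens_iff
      by (meson Suc_leI le_Suc_eq le_trans less_le_trans nat_add_left_cancel_le not_le)
    then show False using assms(2) by simp
  qed
  then have "Max (prev_lens X p) = l"
    using assms(1) by (intro Max_eqI finite_prev_lens)
  then show ?thesis using assms(1) by (auto simp: phrase_len_def)
qed

lemma lz77_starts_distinct:
  assumes "distinct X"
  shows "lz77_starts X = [0..<length X]"
proof -
  \<comment> \<open>Induction on the number \<open>k\<close> of remaining positions, from the end of
    the text backwards.\<close>
  have "lz77_starts_from X (length X - k) = [length X - k..<length X]" if "k \<le> length X" for k
    using that
  proof (induction k)
    case 0
    then show ?case by (simp add: lz77_starts_from.simps)
  next
    case (Suc k)
    have "prev_lens X (length X - Suc k) = {}"
      using assms Suc.prems by (auto simp: prev_lens_empty_iff nth_eq_iff_index_eq)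
    then have "phrase_len X (length X - Suc k) = 1" by (simp add: phrase_len_def)
    moreover have "length X - Suc k + 1 = length X - k" using Suc.prems by simp
    ultimately show ?case
      using Suc by (subst lz77_starts_from.simps) (simp add: upt_conv_Cons Suc_diff_Suc)
  qed
  from this[of "length X"] show ?thesis by (simp add: lz77_starts_def)
qed

lemma lz77_size_distinct: "distinct X \<Longrightarrow> lz77_size X = length X"
  by (simp add: lz77_size_def lz77_starts_distinct)

text \<open>No letter recurs, so every phrase must be a literal.\<close>

lemma is_lz77_distinct:
  assumes "distinct X" "is_lz77 X fs"
  shows "fs = map Literal X"
proof (rule nth_equalityI)
  have all: "list_all2 (encodes_phrase X) [0..<length X] fs"
    using assms by (simp add: is_lz77_def lz77_starts_distinct)
  then show "length fs = length (map Literal X)"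
    by (auto dest: list_all2_lengthD)
  fix i assume "i < length fs"
  then have i: "i < length X" using all by (auto dest: list_all2_lengthD)
  then have "encodes_phrase X i (fs ! i)"
    using list_all2_nthD[OF all, of i] by simp
  moreover have "prev_lens X i = {}"
    using assms(1) i by (auto simp: prev_lens_empty_iff nth_eq_iff_index_eq)
  ultimately show "fs ! i = map Literal X ! i"
    using i by (cases "fs ! i") auto
qed

section \<open>Suffix arrays, transforms and run-length encoding\<close>

lemma length_suffix_array [simp]: "length (suffix_array X) = length X"
  by (simp add: suffix_array_def)

lemma distinct_suffix_array: "distinct (suffix_array X)"
  by (simp add: suffix_array_def)

lemma set_suffix_array: "set (suffix_array X) = {..<length X}"
  by (auto simp: suffix_array_def)

text \<open>Lexicographic order of suffixes implies the order of their first letters.\<close>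

lemma map_nth_suffix_array:
  "map ((!) X) (suffix_array X) = sort X"
proof (rule sym, rule properties_for_sort)
  have "mset (map ((!) X) (suffix_array X)) = mset (map ((!) X) [0..<length X])"
    by (simp add: suffix_array_def)
  then show "mset (map ((!) X) (suffix_array X)) = mset X"
    by (simp only: map_nth)
  have "sorted (map (\<lambda>i. drop i X) (suffix_array X))"
    by (simp add: suffix_array_def)
  then have "sorted_wrt (\<lambda>i j. drop i X \<le> drop j X) (suffix_array X)"
    by (simp add: sorted_map)
  then have "sorted_wrt (\<lambda>i j. X ! i \<le> X ! j) (suffix_array X)"
  proof (rule sorted_wrt_mono_rel[rotated])
    fix i j assume "i \<in> set (suffix_array X)" "j \<in> set (suffix_array X)" "drop i X \<le> drop j X"
    then show "X ! i \<le> X ! j"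
      by (auto simp: set_suffix_array Cons_nth_drop_Suc[symmetric])
  qed
  then show "sorted (map ((!) X) (suffix_array X))"
    by (simp add: sorted_map)
qed

lemma run_length_encode_distinct:
  "distinct xs \<Longrightarrow> run_length_encode xs = map (\<lambda>x. (x, 1)) xs"
  by (induction xs) (auto split: list.split)

text \<open>A left inverse of the encoding, so that an answer determines the whole
  transform.\<close>

lemma concat_replicate_run_length_encode:
  "concat (map (\<lambda>(x, k). replicate k x) (run_length_encode xs)) = xs"
  by (induction xs) (auto split: list.split)

lemma run_length_encode_inject: "run_length_encode xs = run_length_encode ys \<longleftrightarrow> xs = ys"
  by (metis concat_replicate_run_length_encode)

lemma nth_bwt: "k < length X \<Longrightarrow> bwt X ! k = (if suffix_array X ! k \<noteq> 0 then X ! (suffix_array X ! k - 1) else 0)"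
  by (simp add: bwt_def)

lemma ends_with_sentinel_last: "ends_with_sentinel X \<Longrightarrow> X ! (length X - 1) = 0"
  by (auto simp: ends_with_sentinel_def last_conv_nth)

text \<open>The sentinel occurs only at the end and so precedes no position; hence the default
  \<open>0\<close> at position 0 clashes with no other letter. The transform has distinct letters,
  and each run has length one.\<close>

lemma bwt_runs_distinct:
  assumes "distinct X" "ends_with_sentinel X"
  shows "bwt_runs X = length X"
proof -
  have "inj_on (\<lambda>i. if i \<noteq> 0 then X ! (i - 1) else 0) {..<length X}"
  proof (rule inj_onI)
    have 0: "X ! i = 0 \<longleftrightarrow> i = length X - 1" if "i < length X" for i
      using that assms(1) ends_with_sentinel_last[OF assms(2)]
        nth_eq_iff_index_eq[of X i "length X - 1"] by (cases X) auto
    have pos: "X ! (i - 1) \<noteq> 0" if "i < length X" "i \<noteq> 0" for i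
      using 0[of "i - 1"] that by linarith
    fix i j
    assume ij: "i \<in> {..<length X}" "j \<in> {..<length X}"
      and eq: "(if i \<noteq> 0 then X ! (i - 1) else 0) = (if j \<noteq> 0 then X ! (j - 1) else 0)"
    show "i = j"
    proof (cases "i = 0 \<or> j = 0")
      case True
      then show ?thesis using eq ij pos[of i] pos[of j] by (auto split: if_splits)
    next
      case False
      then have "i - 1 = j - 1"
        using eq ij nth_eq_iff_index_eq[OF assms(1), of "i - 1" "j - 1"] by auto
      then show ?thesis using False by linarith
    qed
  qed
  then have "distinct (bwt X)"
    by (simp add: bwt_def distinct_map distinct_suffix_array set_suffix_array)
  then show ?thesis
    by (simp add: bwt_runs_def run_length_encode_distinct bwt_def)
qed

text \<open>Reading the transform as the cyclic predecessor map, the text is recovered from its end.\<close>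

lemma bwt_inject_permutation:
  assumes "distinct X" "distinct Y" "set X = set Y" "ends_with_sentinel X" "ends_with_sentinel Y"
    and bwt: "bwt X = bwt Y"
  shows "X = Y"
proof -
  have len: "length X = length Y"
    using assms by (metis distinct_card)
  have sort: "sort X = sort Y"
    using assms by (intro sorted_distinct_set_unique) auto
  have eq: "X ! (length X - Suc k) = Y ! (length X - Suc k)" if "k < length X" for k
    using that
  proof (induction k)
    case 0
    then show ?case
      using ends_with_sentinel_last[OF assms(4)] ends_with_sentinel_last[OF assms(5)] len by simp
  next
    case (Suc k)
    let ?j = "length X - Suc k"
    have "?j \<in> set (suffix_array X)" using Suc.prems by (simp add: set_suffix_array)
    then obtain c where c: "c < length X" "suffix_array X ! c = ?j"
      by (auto simp: in_set_conv_nth)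
    \<comment> \<open>The sorted letters of both texts coincide, so row \<open>c\<close> of
      \<open>Y\<close> also starts with the letter at \<open>?j\<close> and, by distinctness, is the
      suffix at \<open>?j\<close>. Equal transforms then give equal preceding letters.\<close>
    have "X ! (suffix_array X ! c) = sort X ! c" "Y ! (suffix_array Y ! c) = sort Y ! c"
      using c len by (simp_all flip: map_nth_suffix_array)
    then have "Y ! (suffix_array Y ! c) = Y ! ?j"
      using c Suc sort by simp
    moreover have "suffix_array Y ! c < length Y"
      using c len nth_mem[of c "suffix_array Y"] by (simp add: set_suffix_array)
    ultimately have "suffix_array Y ! c = ?j"
      using assms(2) len Suc.prems by (simp add: nth_eq_iff_index_eq)
    then show ?case
      using nth_bwt[of c X] nth_bwt[of c Y] c len bwt Suc.prems by simp
  qed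
  show ?thesis
  proof (rule nth_equalityI[OF len])
    fix i assume "i < length X"
    then show "X ! i = Y ! i" using eq[of "length X - Suc i"] by simp
  qed
qed

section \<open>Two families of texts\<close>

definition flip_pos :: "nat set \<Rightarrow> nat \<Rightarrow> nat" where
  "flip_pos S p = (if p div 2 \<in> S then if even p then p + 1 else p - 1 else p)"

definition swap_text :: "nat \<Rightarrow> nat set \<Rightarrow> nat list" where
  "swap_text n S = map (\<lambda>p. Suc (flip_pos S p)) [0..<n - 1] @ [0]"

lemma flip_pos_flip_pos [simp]: "flip_pos S (flip_pos S p) = p"
proof -
  have "(p - 1) div 2 = p div 2" "even (p - 1)" "p \<ge> 1" if "odd p"
    using that by (auto elim!: oddE)
  then show ?thesis by (auto simp: flip_pos_def)
qed

lemma inj_flip_pos: "inj_on (flip_pos S) A"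
  by (metis flip_pos_flip_pos inj_onI)

text \<open>Both members of a swapped pair lie below \<open>2 * m\<close>; all other positions stay
  put.\<close>

lemma flip_pos_less:
  assumes "S \<subseteq> {..<m}" "2 * m \<le> k" "p < k"
  shows "flip_pos S p < k"
proof (cases "p div 2 \<in> S")
  case True
  then have "p div 2 < m" using assms by auto
  then have "p + 1 < k \<or> odd p" using assms by presburger
  then show ?thesis using assms by (auto simp: flip_pos_def)
qed (use assms in \<open>simp add: flip_pos_def\<close>)

lemma length_swap_text: "0 < n \<Longrightarrow> length (swap_text n S) = n"
  by (simp add: swap_text_def)

lemma nth_swap_text: "p < n - 1 \<Longrightarrow> swap_text n S ! p = Suc (flip_pos S p)"
  by (simp add: swap_text_def nth_append)

lemma nth_swap_text_last: "swap_text n S ! (n - 1) = 0"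
  by (simp add: swap_text_def nth_append)

lemma distinct_swap_text: "distinct (swap_text n S)"
  by (auto simp: swap_text_def distinct_map intro!: comp_inj_on[of "flip_pos S" _ Suc, unfolded comp_def] inj_flip_pos)

text \<open>The letters are \<open>n\<close> distinct numbers below \<open>n\<close>, so counting
  suffices.\<close>

lemma set_swap_text:
  assumes "S \<subseteq> {..<m}" "2 * m \<le> n - 1" "0 < n"
  shows "set (swap_text n S) = {..<n}"
proof (rule card_subset_eq)
  show "set (swap_text n S) \<subseteq> {..<n}"
    using flip_pos_less[OF assms(1,2)] assms(3) by (fastforce simp: swap_text_def)
  show "card (set (swap_text n S)) = card {..<n}"
    using assms(3) by (simp add: distinct_card distinct_swap_text length_swap_text)
qed simp

lemma ends_with_sentinel_swap_text: "ends_with_sentinel (swap_text n S)"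
  by (auto simp: ends_with_sentinel_def swap_text_def)

text \<open>The letter at the even position of a pair shows whether the pair is swapped.\<close>

lemma swap_text_inject:
  assumes "S \<subseteq> {..<m}" "S' \<subseteq> {..<m}" "2 * m \<le> n - 1" "swap_text n S = swap_text n S'"
  shows "S = S'"
proof -
  have "k \<in> S \<longleftrightarrow> k \<in> S'" if "k < m" for k
  proof -
    have "2 * k < n - 1" using that assms by simp
    then have "flip_pos S (2 * k) = flip_pos S' (2 * k)"
      using nth_swap_text[of "2 * k" n S] nth_swap_text[of "2 * k" n S'] assms(4) by simp
    then show ?thesis by (simp add: flip_pos_def split: if_splits)
  qed
  then show ?thesis using assms by auto
qed

text \<open>A letter depends only on the swap of its own pair, and the last letter on no swap at
  all.\<close>

lemma nth_swap_text_neq: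
  assumes "swap_text n S ! p \<noteq> swap_text n S' ! p" "p < n"
  shows "p div 2 \<in> S \<longleftrightarrow> p div 2 \<notin> S'"
proof -
  have "p < n - 1"
    using assms nth_swap_text_last[of n] by (metis Suc_pred' less_SucE less_nat_zero_code not_gr_zero)
  then show ?thesis using assms by (auto simp: nth_swap_text flip_pos_def split: if_splits)
qed

section \<open>Texts with one marked letter\<close>

definition mark_text :: "nat \<Rightarrow> nat \<Rightarrow> nat list" where
  "mark_text n i = replicate i 1 @ 2 # replicate (n - 2 - i) 1 @ [0]"

lemma length_mark_text: "i + 2 \<le> n \<Longrightarrow> length (mark_text n i) = n"
  by (simp add: mark_text_def)

lemma nth_mark_text:
  assumes "i + 2 \<le> n" "p < n"
  shows "mark_text n i ! p = (if p = i then 2 else if p = n - 1 then 0 else 1)"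
  using assms by (auto simp: mark_text_def nth_append nth_Cons split: nat.splits)

lemma set_mark_text: "set (mark_text n i) \<subseteq> {0, 1, 2}"
  by (auto simp: mark_text_def)

lemma ends_with_sentinel_mark_text: "ends_with_sentinel (mark_text n i)"
  by (auto simp: ends_with_sentinel_def mark_text_def butlast_append)

lemma nth_mark_text_neq:
  assumes "mark_text n i ! p \<noteq> mark_text n j ! p" "p < n" "i + 2 \<le> n" "j + 2 \<le> n"
  shows "p = i \<or> p = j"
  using assms by (auto simp: nth_mark_text split: if_splits)

text \<open>The phrases are a first \<open>1\<close>, a self-overlapping copy of
  \<open>i - 1\<close> ones from position 0, the mark, the second run of ones, and the sentinel. The
  bound \<open>n \<le> 2 * i + 2\<close> makes the second run no longer than the first, so that it
  is a single phrase; the other two bounds make both copies nonempty.\<close>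

lemma lz77_mark_text:
  assumes "2 \<le> i" "i + 3 \<le> n" "n \<le> 2 * i + 2"
  shows "lz77_starts (mark_text n i) = [0, 1, i, i + 1, n - 1]"
    and "phrase_len (mark_text n i) 1 = i - 1"
    and "prev_lens (mark_text n i) 1 \<noteq> {}"
proof -
  let ?X = "mark_text n i"
  have len: "length ?X = n" and nth: "\<And>p. p < n \<Longrightarrow> ?X ! p = (if p = i then 2 else if p = n - 1 then 0 else 1)"
    using assms by (simp_all add: length_mark_text nth_mark_text)
  have 0: "phrase_len ?X 0 = 1"
    by (simp add: phrase_len_def prev_lens_def)
  have mem1: "i - 1 \<in> prev_lens ?X 1"
    using assms by (auto simp: mem_prev_lens_iff len nth)
  \<comment> \<open>The only possible source is 0; at offset \<open>i - 1\<close> the target reaches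
    the mark while the source still reads \<open>1\<close>.\<close>
  have "Suc (i - 1) \<notin> prev_lens ?X 1"
    using assms by (auto simp: mem_prev_lens_iff len nth intro!: exI[of _ "i - 1"])
  with mem1 show 1: "phrase_len ?X 1 = i - 1" by (rule phrase_len_eqI)
  show "prev_lens ?X 1 \<noteq> {}" using mem1 by auto
  have "prev_lens ?X i = {}"
    using assms by (auto simp: prev_lens_empty_iff len nth)
  then have 2: "phrase_len ?X i = 1" by (simp add: phrase_len_def)
  have 3: "phrase_len ?X (i + 1) = n - 2 - i"
  proof (rule phrase_len_eqI)
    show "n - 2 - i \<in> prev_lens ?X (i + 1)"
      using assms by (auto simp: mem_prev_lens_iff len nth intro!: exI[of _ 0])
    \<comment> \<open>At offset \<open>n - 2 - i\<close> the target reaches the sentinel, which does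
      not occur earlier.\<close>
    show "Suc (n - 2 - i) \<notin> prev_lens ?X (i + 1)"
      using assms by (auto simp: mem_prev_lens_iff len nth intro!: exI[of _ "n - 2 - i"])
  qed
  have "prev_lens ?X (n - 1) = {}"
    using assms by (auto simp: prev_lens_empty_iff len nth)
  then have 4: "phrase_len ?X (n - 1) = 1" by (simp add: phrase_len_def)
  have "lz77_starts_from ?X n = []"
    by (simp add: lz77_starts_from.simps len)
  then have "lz77_starts_from ?X (n - 1) = [n - 1]"
    using 4 assms by (subst lz77_starts_from.simps) (simp add: len)
  then have "lz77_starts_from ?X (i + 1) = [i + 1, n - 1]"
    using 3 assms by (subst lz77_starts_from.simps) (simp add: len numeral_2_eq_2 Suc_diff_Suc)
  then have "lz77_starts_from ?X i = [i, i + 1, n - 1]"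
    using 2 assms by (subst lz77_starts_from.simps) (simp add: len)
  then have "lz77_starts_from ?X 1 = [1, i, i + 1, n - 1]"
    using 1 assms by (subst lz77_starts_from.simps) (simp add: len)
  then show "lz77_starts ?X = [0, 1, i, i + 1, n - 1]"
    using 0 assms unfolding lz77_starts_def by (subst lz77_starts_from.simps) (simp add: len)
qed

text \<open>Whatever source is reported, the second phrase is a copy of length \<open>i - 1\<close>,
  which reveals the mark.\<close>

lemma is_lz77_mark_text_inject:
  assumes "2 \<le> i" "i + 3 \<le> n" "n \<le> 2 * i + 2" "2 \<le> j" "j + 3 \<le> n" "n \<le> 2 * j + 2"
    and "is_lz77 (mark_text n i) fs" "is_lz77 (mark_text n j) fs"
  shows "i = j"
proof -
  have "\<exists>q. fs ! 1 = Copy q (k - 1)"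
    if "2 \<le> k" "k + 3 \<le> n" "n \<le> 2 * k + 2" "is_lz77 (mark_text n k) fs" for k
  proof -
    have "encodes_phrase (mark_text n k) 1 (fs ! 1)"
      using list_all2_nthD[OF that(4)[unfolded is_lz77_def], of 1] lz77_mark_text(1)[OF that(1-3)] by simp
    then show ?thesis
      using lz77_mark_text(2,3)[OF that(1-3)] by (cases "fs ! 1") auto
  qed
  from this[of i] this[of j] have "i - 1 = j - 1" using assms by auto
  then show ?thesis using assms by simp
qed

section \<open>Suffix order and transform of the marked texts\<close>

lemma replicate_append_le_same:
  fixes c d :: "'a::linorder"
  assumes "d < c"
  shows "a \<le> b \<Longrightarrow> replicate a c @ [d] \<le> replicate b c @ [d]"
proof (induction a arbitrary: b)
  case 0
  then show ?case using assms by (cases b) auto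
next
  case (Suc a)
  then show ?case by (cases b) auto
qed

lemma replicate_append_le_decreasing:
  fixes c d :: "'a::linorder"
  assumes "c < d"
  shows "a \<le> b \<Longrightarrow> replicate b c @ d # zs \<le> replicate a c @ d # zs"
proof (induction a arbitrary: b)
  case 0
  then show ?case using assms by (cases b) auto
next
  case (Suc a)
  then show ?case by (cases b) auto
qed

text \<open>Whichever run ends first decides, as \<open>e\<close> lies below \<open>c\<close> and
  \<open>d\<close> above it; if both end together, \<open>e\<close> meets \<open>d\<close>.\<close>

lemma replicate_append_le_cross:
  fixes c d e :: "'a::linorder"
  assumes "e < c" "c < d"
  shows "replicate a c @ [e] \<le> replicate b c @ d # zs"
proof (induction a arbitrary: b)
  case 0
  then show ?case using assms by (cases b) auto
next
  case (Suc a)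
  then show ?case using assms by (cases b) auto
qed

lemma inj_on_drop: "inj_on (\<lambda>i. drop i X) {..<length X}"
proof (rule inj_onI)
  fix i j assume "i \<in> {..<length X}" "j \<in> {..<length X}" "drop i X = drop j X"
  then have "length X - i = length X - j" by (metis length_drop)
  then show "i = j" using \<open>i \<in> _\<close> \<open>j \<in> _\<close> by auto
qed

text \<open>Suffixes beyond the mark are runs of ones closed by \<open>0\<close>; they grow with
  their length and so appear in reverse order. In the others the run is closed by \<open>2\<close>,
  so a longer run is smaller and they appear in text order, after all of the former. Distinct
  suffixes make the sorted arrangement unique.\<close>

lemma suffix_array_mark_text:
  assumes "i + 2 \<le> n"
  shows "suffix_array (mark_text n i) = rev [i + 1..<n] @ [0..<i + 1]"
  unfolding suffix_array_def
proof (rule sort_key_inj_key_eq)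
  let ?X = "mark_text n i"
  have left: "drop p ?X = replicate (i - p) 1 @ 2 # replicate (n - 2 - i) 1 @ [0]" if "p \<le> i" for p
    using that by (simp add: mark_text_def)
  have right: "drop p ?X = replicate (n - 1 - p) 1 @ [0]" if "i < p" "p < n" for p
  proof -
    have "p - i = Suc (p - Suc i)" using that by simp
    then show ?thesis using that by (simp add: mark_text_def)
  qed
  show "mset [0..<length ?X] = mset (rev [i + 1..<n] @ [0..<i + 1])"
  proof -
    have "[0..<n] = [0..<i + 1] @ [i + 1..<n]"
      using assms upt_add_eq_append[of 0 "i + 1" "n - (i + 1)"] by simp
    then show ?thesis using assms by (simp add: length_mark_text)
  qed
  show "inj_on (\<lambda>i. drop i ?X) (set [0..<length ?X])"
    using inj_on_drop[of ?X] by (simp add: lessThan_atLeast0)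
  have "sorted_wrt (\<lambda>p q. drop p ?X \<le> drop q ?X) (rev [i + 1..<n])"
    unfolding sorted_wrt_rev
    by (rule sorted_wrt_mono_rel[OF _ sorted_wrt_upt])
      (auto simp: right intro!: replicate_append_le_same)
  moreover have "sorted_wrt (\<lambda>p q. drop p ?X \<le> drop q ?X) [0..<i + 1]"
    by (rule sorted_wrt_mono_rel[OF _ sorted_wrt_upt])
      (auto simp: left simp del: upt_Suc intro!: replicate_append_le_decreasing)
  moreover have "drop p ?X \<le> drop q ?X" if "p \<in> set (rev [i + 1..<n])" "q \<in> set [0..<i + 1]" for p q
    using that by (auto simp: left right simp del: upt_Suc intro!: replicate_append_le_cross)
  ultimately show "sorted (map (\<lambda>i. drop i ?X) (rev [i + 1..<n] @ [0..<i + 1]))"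
    unfolding sorted_map sorted_wrt_append by blast
qed

lemma run_length_encode_replicate_append:
  assumes "0 < k" "xs = [] \<or> hd xs \<noteq> x"
  shows "run_length_encode (replicate k x @ xs) = (x, k) # run_length_encode xs"
  using assms(1)
proof (induction k rule: nat_induct_non_zero)
  case 1
  show ?case using assms(2)
    by (cases xs) (auto split: list.split)
qed simp

text \<open>Position \<open>i + 1\<close> is preceded by the mark, position 0 contributes the
  sentinel, and every other position is preceded by \<open>1\<close>.\<close>

lemma bwt_mark_text:
  assumes "i + 2 \<le> n"
  shows "bwt (mark_text n i) = replicate (n - 2 - i) 1 @ replicate 1 2 @ replicate 1 0 @ replicate i 1"
proof -
  have "[i + 1..<n] = (i + 1) # [i + 2..<n]"
    using assms by (simp add: upt_conv_Cons)
  then have sa: "suffix_array (mark_text n i) = rev [i + 2..<n] @ (i + 1) # 0 # [1..<i + 1]"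
    using assms by (simp add: suffix_array_mark_text upt_conv_Cons del: upt_Suc)
  let ?f = "\<lambda>p. if p \<noteq> 0 then mark_text n i ! (p - 1) else 0"
  have "map ?f (rev [i + 2..<n]) = map (\<lambda>_. 1) (rev [i + 2..<n])"
    using assms by (intro map_cong refl) (auto simp: nth_mark_text)
  moreover have "map ?f [1..<i + 1] = map (\<lambda>_. 1) [1..<i + 1]"
    using assms by (intro map_cong refl) (auto simp: nth_mark_text simp del: upt_Suc)
  moreover have "?f (i + 1) = 2" using assms by (simp add: nth_mark_text)
  ultimately show ?thesis
    unfolding bwt_def sa map_append list.map by (simp add: map_replicate_const del: upt_Suc)
qed

lemma run_length_encode_bwt_mark_text:
  assumes "1 \<le> i" "i + 3 \<le> n"
  shows "run_length_encode (bwt (mark_text n i)) = [(1, n - 2 - i), (2, 1), (0, 1), (1, i)]"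
  using assms run_length_encode_replicate_append[of i "[]" "1 :: nat"]
  by (simp add: bwt_mark_text run_length_encode_replicate_append del: replicate.simps)

section \<open>Lower bounds\<close>

text \<open>The adversary argument for unordered search, with degree of order n against a price of
  sqrt n per position. In the applications \<open>c\<close> is the constant number of phrases or
  runs.\<close>

lemma requires_queries_mark_text:
  assumes P: "\<And>n i. 2 \<le> i \<Longrightarrow> i + 3 \<le> n \<Longrightarrow> n \<le> 2 * i + 2 \<Longrightarrow> P n (mark_text n i)"
    and sep: "\<And>n i j y. 2 \<le> i \<Longrightarrow> i + 3 \<le> n \<Longrightarrow> n \<le> 2 * i + 2 \<Longrightarrow>
      2 \<le> j \<Longrightarrow> j + 3 \<le> n \<Longrightarrow> n \<le> 2 * j + 2 \<Longrightarrow>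
      correct (mark_text n i) y \<Longrightarrow> correct (mark_text n j) y \<Longrightarrow> i = j"
    and "0 < c"
  shows "requires_queries P correct (\<lambda>n. sqrt (c * real n))"
  unfolding requires_queries_def
proof (intro allI impI)
  fix w and A :: "nat \<Rightarrow> 'a qalg"
  assume ev: "\<forall>\<^sub>F n in sequentially. n \<le> 2 ^ w n \<and> solves n (w n) (P n) correct (A n)"
  have main: "sqrt (real n) \<le> 144 * real (queries (A n))"
    if n: "n \<le> 2 ^ w n" "solves n (w n) (P n) correct (A n)" "16 \<le> n" for n
  proof -
    \<comment> \<open>The lower end ensures \<open>n \<le> 2 * i + 2\<close>, the upper end
      \<open>i + 3 \<le> n\<close>.\<close>
    define I where "I = {n div 2..n - 3}"
    define R where "R = I \<times> I - Id"
    \<comment> \<open>At the mark of \<open>i\<close> up to \<open>n\<close> neighbours differ, each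
      at price 1 / sqrt n; at another position \<open>p\<close> only the neighbour marked at
      \<open>p\<close> can differ, at price sqrt n. Both totals are at most sqrt n, and the two
      prices of a pair multiply to 1.\<close>
    define u where "u i j p = (if p = i then 1 / sqrt (real n) else sqrt (real n))" for i j p :: nat
    have I: "2 \<le> i" "i + 3 \<le> n" "n \<le> 2 * i + 2" if "i \<in> I" for i
      using that n(3) by (auto simp: I_def)
    have [simp]: "finite I" by (simp add: I_def)
    have cardI: "card I = n - 2 - n div 2" using n(3) by (simp add: I_def)
    have R_card: "card R = card I * card I - card I"
    proof -
      have "R = I \<times> I - (\<lambda>i. (i, i)) ` I" by (auto simp: R_def)
      moreover have "card ((\<lambda>i. (i, i)) ` I) = card I" by (rule card_image) (auto simp: inj_on_def)
      ultimately show ?thesis by (simp add: card_Diff_subset image_subset_iff card_cartesian_product)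
    qed
    have "real (card I) - 1 \<le> 36 * sqrt (real n) * real (queries (A n))"
    proof (rule adversary_bound[where X = "mark_text n" and I = I and R = R and u = u
          and P = "P n" and correct = correct])
      show "I \<noteq> {}" using n(3) by (auto simp: I_def)
      show "mark_text n i \<in> texts n (w n)" if "i \<in> I" for i
        using I[OF that] n set_mark_text[of n i] by (fastforce simp: texts_def length_mark_text)
      show "\<not> correct (mark_text n j) y" if "(i, j) \<in> R" "correct (mark_text n i) y" for i j y
      proof -
        have "i \<in> I" "j \<in> I" "i \<noteq> j" using that(1) by (auto simp: R_def)
        then show ?thesis using sep[OF I I] that(2) by blast
      qed
      show "0 < u i j p \<and> 1 \<le> u i j p * u j i p"
        if "(i, j) \<in> R" "p < n" "mark_text n i ! p \<noteq> mark_text n j ! p" for i j p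
        using that nth_mark_text_neq[OF that(3,2)] I[of i] I[of j] n(3) by (auto simp: u_def R_def)
      show "(\<Sum>j | (i, j) \<in> R \<and> mark_text n i ! p \<noteq> mark_text n j ! p. u i j p) \<le> sqrt (real n)"
        if i: "i \<in> I" and "p < n" for i p
      proof -
        let ?N = "{j. (i, j) \<in> R \<and> mark_text n i ! p \<noteq> mark_text n j ! p}"
        have N: "?N \<subseteq> I" by (auto simp: R_def)
        show ?thesis
        proof (cases "p = i")
          case True
          have "card ?N \<le> n"
            using card_mono[OF \<open>finite I\<close> N] cardI by linarith
          then have "(\<Sum>j\<in>?N. u i j p) \<le> real n * (1 / sqrt (real n))"
            using True by (simp add: u_def divide_right_mono)
          then show ?thesis by (simp add: real_div_sqrt)
        next
          case False
          have "?N \<subseteq> {p}"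
            using nth_mark_text_neq[OF _ \<open>p < n\<close>, of i] False I[OF i] I N by fastforce
          then have "(\<Sum>j\<in>?N. u i j p) \<le> (\<Sum>j\<in>{p}. u i j p)"
            by (intro sum_mono2) (auto simp: u_def)
          then show ?thesis using False by (simp add: u_def)
        qed
      qed
      show "(real (card I) - 1) * real (card I) \<le> real (card R)"
        unfolding R_card by (simp add: of_nat_diff algebra_simps)
      show "sym R" by (auto simp: R_def sym_def)
    qed (use n I P in \<open>auto simp: R_def\<close>)
    \<comment> \<open>Since \<open>card I\<close> is at least n / 2 - 2, the bound
      \<open>16 \<le> n\<close> suffices; the constant is 144 = 36 * 4.\<close>
    moreover have "real n / 4 \<le> real (card I) - 1"
      using n(3) unfolding cardI by linarith
    ultimately have "sqrt (real n) * sqrt (real n) \<le> sqrt (real n) * (144 * real (queries (A n)))"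
      by simp
    moreover have "0 < sqrt (real n)" using n(3) by simp
    ultimately show ?thesis by (rule mult_left_le_imp_le)
  qed
  show "(\<lambda>n. real (queries (A n))) \<in> \<Omega>(\<lambda>n. sqrt (c * real n))"
  proof (rule landau_omega.bigI)
    show "0 < 1 / (144 * sqrt c)" using \<open>0 < c\<close> by simp
    show "\<forall>\<^sub>F n in sequentially.
        1 / (144 * sqrt c) * norm (sqrt (c * real n)) \<le> norm (real (queries (A n)))"
      using ev eventually_ge_at_top[of 16]
    proof eventually_elim
      case (elim n)
      then show ?case using main[of n] \<open>0 < c\<close> by (simp add: real_sqrt_mult)
    qed
  qed
qed

text \<open>Each of the \<open>m\<close> swaps gives a neighbour, and each position reveals at most
  one of them. Unit prices thus total at most 1 against degree \<open>m\<close>, which is linear in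
  \<open>n\<close>.\<close>

lemma requires_queries_swap_text:
  assumes P: "\<And>n m S. S \<subseteq> {..<m} \<Longrightarrow> 2 * m \<le> n - 1 \<Longrightarrow> 0 < n \<Longrightarrow> P n (swap_text n S)"
    and sep: "\<And>n m S T y. S \<subseteq> {..<m} \<Longrightarrow> T \<subseteq> {..<m} \<Longrightarrow> 2 * m \<le> n - 1 \<Longrightarrow> 0 < n \<Longrightarrow>
      correct (swap_text n S) y \<Longrightarrow> correct (swap_text n T) y \<Longrightarrow> S = T"
  shows "requires_queries P correct (\<lambda>n. sqrt (real n * real n))"
  unfolding requires_queries_def
proof (intro allI impI)
  fix w and A :: "nat \<Rightarrow> 'a qalg"
  assume ev: "\<forall>\<^sub>F n in sequentially. n \<le> 2 ^ w n \<and> solves n (w n) (P n) correct (A n)"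
  have main: "real n \<le> 144 * real (queries (A n))"
    if n: "n \<le> 2 ^ w n" "solves n (w n) (P n) correct (A n)" "16 \<le> n" for n
  proof -
    \<comment> \<open>The number of full pairs before the sentinel.\<close>
    define m where "m = (n - 1) div 2"
    define I where "I = Pow {..<m}"
    define flip where "flip S k = sym_diff S {k}" for S :: "nat set" and k
    define R where "R = (\<lambda>(S, k). (S, flip S k)) ` (I \<times> {..<m})"
    have [simp]: "finite I" by (simp add: I_def)
    have m: "2 * m \<le> n - 1" "0 < n" using n(3) by (auto simp: m_def)
    have I: "S \<subseteq> {..<m}" if "S \<in> I" for S using that by (simp add: I_def)
    have flip_I: "flip S k \<in> I" if "S \<in> I" "k < m" for S k
      using that by (auto simp: flip_def I_def)
    have flip_eq: "T = flip S k" if "(S, T) \<in> R" "k \<in> S \<longleftrightarrow> k \<notin> T" for S T k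
      using that by (auto simp: R_def flip_def)
    have card_R: "card R = card I * m"
    proof -
      \<comment> \<open>Different swaps lead to different neighbours, so every text has exactly
        \<open>m\<close> of them.\<close>
      have "k = l" if "flip S k = flip S l" for S k l
        using that by (auto simp: flip_def set_eq_iff split: if_splits)
      then have "inj_on (\<lambda>(S, k). (S, flip S k)) (I \<times> {..<m})"
        by (auto simp: inj_on_def)
      then show ?thesis by (simp add: R_def card_image card_cartesian_product)
    qed
    have "real m \<le> 36 * 1 * real (queries (A n))"
    proof (rule adversary_bound[where X = "swap_text n" and I = I and R = R
          and u = "\<lambda>_ _ _. 1" and P = "P n" and correct = correct])
      show "I \<noteq> {}" by (auto simp: I_def)
      \<comment> \<open>All numbers below \<open>n\<close> occur as letters;
        \<open>n \<le> 2 ^ w n\<close> makes them fit.\<close>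
      show "swap_text n S \<in> texts n (w n)" if "S \<in> I" for S
        using set_swap_text[OF I[OF that] m] n(1) m by (auto simp: texts_def length_swap_text)
      show "P n (swap_text n S)" if "S \<in> I" for S
        using P[OF I[OF that] m] .
      show "R \<subseteq> I \<times> I" using flip_I by (auto simp: R_def)
      show "sym R"
      proof (rule symI)
        fix S T assume "(S, T) \<in> R"
        then obtain k where k: "S \<in> I" "k < m" "T = flip S k" by (auto simp: R_def)
        then have "S = flip T k" by (auto simp: flip_def)
        then show "(T, S) \<in> R" using k flip_I unfolding R_def by force
      qed
      show "\<not> correct (swap_text n T) y" if ST: "(S, T) \<in> R" "correct (swap_text n S) y" for S T y
      proof
        assume "correct (swap_text n T) y"
        moreover obtain k where k: "S \<in> I" "k < m" "T = flip S k"
          using ST by (auto simp: R_def)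
        ultimately have "S = T" using sep[OF I I m ST(2)] flip_I by blast
        then show False using k by (auto simp: flip_def)
      qed
      show "(\<Sum>T | (S, T) \<in> R \<and> swap_text n S ! p \<noteq> swap_text n T ! p. 1) \<le> (1 :: real)"
        if "p < n" for S p
      proof -
        \<comment> \<open>A difference at \<open>p\<close> pins the neighbour down to the one
          toggling the pair of \<open>p\<close>.\<close>
        have "{T. (S, T) \<in> R \<and> swap_text n S ! p \<noteq> swap_text n T ! p} \<subseteq> {flip S (p div 2)}"
          using nth_swap_text_neq[OF _ that] flip_eq by blast
        then have "card {T. (S, T) \<in> R \<and> swap_text n S ! p \<noteq> swap_text n T ! p} \<le> 1"
          using card_mono[of "{flip S (p div 2)}"] by simp
        then show ?thesis by simp
      qed
      show "real m * real (card I) \<le> real (card R)" by (simp add: card_R)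
    qed (use n m in auto)
    moreover have "real n / 4 \<le> real m" using n(3) unfolding m_def by linarith
    ultimately show ?thesis by simp
  qed
  show "(\<lambda>n. real (queries (A n))) \<in> \<Omega>(\<lambda>n. sqrt (real n * real n))"
  proof (rule landau_omega.bigI)
    show "\<forall>\<^sub>F n in sequentially.
        1 / 144 * norm (sqrt (real n * real n)) \<le> norm (real (queries (A n)))"
      using ev eventually_ge_at_top[of 16]
    proof eventually_elim
      case (elim n)
      then show ?case using main[of n] by simp
    qed
  qed simp
qed

theorem theorem7p1:
  shows
    "(\<exists>z :: nat \<Rightarrow> nat. (\<lambda>n. real (z n)) \<in> \<Theta>(\<lambda>n. 1) \<and>
        requires_queries (\<lambda>n X. lz77_size X = z n) is_lz77 (\<lambda>n. sqrt (real (z n) * real n)))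
   \<and> (\<exists>z :: nat \<Rightarrow> nat. (\<lambda>n. real (z n)) \<in> \<Theta>(\<lambda>n. real n) \<and>
        requires_queries (\<lambda>n X. lz77_size X = z n) is_lz77 (\<lambda>n. sqrt (real (z n) * real n)))
   \<and> (\<exists>r :: nat \<Rightarrow> nat. (\<lambda>n. real (r n)) \<in> \<Theta>(\<lambda>n. 1) \<and>
        requires_queries (\<lambda>n X. ends_with_sentinel X \<and> bwt_runs X = r n) is_rlbwt
          (\<lambda>n. sqrt (real (r n) * real n)))
   \<and> (\<exists>r :: nat \<Rightarrow> nat. (\<lambda>n. real (r n)) \<in> \<Theta>(\<lambda>n. real n) \<and>
        requires_queries (\<lambda>n X. ends_with_sentinel X \<and> bwt_runs X = r n) is_rlbwt
          (\<lambda>n. sqrt (real (r n) * real n)))"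
proof (intro conjI)
  have "requires_queries (\<lambda>n X. lz77_size X = 5) is_lz77 (\<lambda>n. sqrt (real 5 * real n))"
    by (rule requires_queries_mark_text)
      (auto simp: lz77_size_def lz77_mark_text intro: is_lz77_mark_text_inject)
  then show "\<exists>z :: nat \<Rightarrow> nat. (\<lambda>n. real (z n)) \<in> \<Theta>(\<lambda>n. 1) \<and>
      requires_queries (\<lambda>n X. lz77_size X = z n) is_lz77 (\<lambda>n. sqrt (real (z n) * real n))"
    by (intro exI[of _ "\<lambda>_. 5"] conjI) simp_all
  \<comment> \<open>Encodings for different marks differ in the length of their last run, which is
    \<open>i\<close>.\<close>
  have "requires_queries (\<lambda>n X. ends_with_sentinel X \<and> bwt_runs X = 4) is_rlbwt
      (\<lambda>n. sqrt (real 4 * real n))"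
    by (rule requires_queries_mark_text)
      (auto simp: ends_with_sentinel_mark_text bwt_runs_def is_rlbwt_def
        run_length_encode_bwt_mark_text)
  then show "\<exists>r :: nat \<Rightarrow> nat. (\<lambda>n. real (r n)) \<in> \<Theta>(\<lambda>n. 1) \<and>
      requires_queries (\<lambda>n X. ends_with_sentinel X \<and> bwt_runs X = r n) is_rlbwt
        (\<lambda>n. sqrt (real (r n) * real n))"
    by (intro exI[of _ "\<lambda>_. 4"] conjI) simp_all
  have "requires_queries (\<lambda>n X. lz77_size X = n) is_lz77 (\<lambda>n. sqrt (real n * real n))"
  proof (rule requires_queries_swap_text)
    fix n m S T fs
    assume S: "S \<subseteq> {..<m}" "T \<subseteq> {..<m}" "2 * m \<le> n - 1"
      and "is_lz77 (swap_text n S) fs" "is_lz77 (swap_text n T) fs"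
    then have "map Literal (swap_text n S) = map Literal (swap_text n T)"
      using is_lz77_distinct[OF distinct_swap_text] by metis
    then have "swap_text n S = swap_text n T"
      by (simp add: inj_map_eq_map inj_def)
    then show "S = T" using swap_text_inject[OF S] by simp
  qed (simp add: lz77_size_distinct distinct_swap_text length_swap_text)
  then show "\<exists>z :: nat \<Rightarrow> nat. (\<lambda>n. real (z n)) \<in> \<Theta>(\<lambda>n. real n) \<and>
      requires_queries (\<lambda>n X. lz77_size X = z n) is_lz77 (\<lambda>n. sqrt (real (z n) * real n))"
    by (intro exI[of _ "\<lambda>n. n"] conjI) simp_all
  have "requires_queries (\<lambda>n X. ends_with_sentinel X \<and> bwt_runs X = n) is_rlbwt
      (\<lambda>n. sqrt (real n * real n))"
  proof (rule requires_queries_swap_text)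
    fix n m S T rs
    assume S: "S \<subseteq> {..<m}" "T \<subseteq> {..<m}" "2 * m \<le> n - 1" "0 < n"
      and "is_rlbwt (swap_text n S) rs" "is_rlbwt (swap_text n T) rs"
    then have "run_length_encode (bwt (swap_text n S)) = run_length_encode (bwt (swap_text n T))"
      by (simp only: is_rlbwt_def)
    then have bwt: "bwt (swap_text n S) = bwt (swap_text n T)"
      by (rule run_length_encode_inject[THEN iffD1])
    have set: "set (swap_text n S) = set (swap_text n T)"
      using set_swap_text[OF S(1,3,4)] set_swap_text[OF S(2,3,4)] by simp
    \<comment> \<open>Both texts are permutations of the same letters, so the transform determines
      the text.\<close>
    have "swap_text n S = swap_text n T"
      by (rule bwt_inject_permutation[OF _ _ set _ _ bwt])
        (rule distinct_swap_text ends_with_sentinel_swap_text)+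
    then show "S = T" using swap_text_inject[OF S(1-3)] by simp
  qed (simp add: bwt_runs_distinct distinct_swap_text ends_with_sentinel_swap_text length_swap_text)
  then show "\<exists>r :: nat \<Rightarrow> nat. (\<lambda>n. real (r n)) \<in> \<Theta>(\<lambda>n. real n) \<and>
      requires_queries (\<lambda>n X. ends_with_sentinel X \<and> bwt_runs X = r n) is_rlbwt
        (\<lambda>n. sqrt (real (r n) * real n))"
    by (intro exI[of _ "\<lambda>n. n"] conjI) simp_all
qed

end
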